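(* Fix a compositional syntactic measure $f$ on $\mathrm{FO}^k(\tau)$ and domain-consistent sets $\mathscr{A},\mathscr{B}$ of structure-assignment pairs with $\mathsf{dom}(\mathscr{A})\subseteq\{x_1,\dots,x_k\}$. Spoiler has a winning strategy in the game $\mathrm{SG}(r,k,f)$ on $(\mathscr{A},\mathscr{B})$ if and only if there is a formula $\varphi\in\mathrm{FO}^k(\tau)$ with $f(\varphi)=r$ that is separating for $(\mathscr{A},\mathscr{B})$.
   Context: $\tau$ has finitely many relation and constant symbols; $\mathsf{Pred}(\tau)$ is its set of predicate symbols, with equality treated as an ordinary binary predicate. $\mathrm{FO}^k(\tau)$ is the set of first-order formulas over $\tau$ using only variables $x_1,\dots,x_k$. A compositional syntactic measure is a function $f:\mathrm{FO}^k(\tau)\to\mathbb{N}$ given by functions $h_\neg,h_\exists,h_\forall:\mathbb{N}\to\mathbb{N}$, $h_\vee,h_\wedge:\mathbb{N}^2\to\mathbb{N}$, $h_{\mathsf{atomic}}:\mathsf{Pred}(\tau)\to\mathbb{N}$ with $f(P(t_1,\dots,t_m))=h_{\mathsf{atomic}}(P)$, $f(\neg\psi)=h_\neg(f(\psi))$, $f(\psi\vee\gamma)=h_\vee(f(\psi),f(\gamma))$, $f(\psi\wedge\gamma)=h_\wedge(f(\psi),f(\gamma))$, $f(\exists x\psi)=h_\exists(f(\psi))$, $f(\forall x\psi)=h_\forall(f(\psi))$. A structure-assignment pair $(\mathbf{A},\alpha)$ is a $\tau$-structure with a partial map $\alpha$ from variables to its universe; equivalently a structure with pebble of color $x_i$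 on $\alpha(x_i)$. $(\mathbf{A},\alpha)\models\psi$ (for $\mathsf{Free}(\psi)\subseteq\mathsf{dom}(\alpha)$) is satisfaction under $\alpha$. Sets $\mathscr{A},\mathscr{B}$ are domain-consistent if all their pairs have assignments with the same domain $\mathsf{dom}(\mathscr{A})$. A separating formula for $(\mathscr{A},\mathscr{B})$ is $\psi$ with $\mathsf{Free}(\psi)\subseteq\mathsf{dom}(\mathscr{A})$ satisfied by every pair in $\mathscr{A}$ and whose negation is satisfied by every pair in $\mathscr{B}$. The game $\mathrm{SG}(r,k,f)$ on $(\mathscr{A},\mathscr{B})$: players grow a tree whose nodes are triples $(\mathscr{A}',\mathscr{B}',r')$ of domain-consistent sets and a counter; root $(\mathscr{A},\mathscr{B},r)$ is an open leaf. On an open leaf $X=(\mathscr{A}',\mathscr{B}',r')$ Spoiler may: (Pebble-Left, if $h_\exists^{-1}(r')\neq\emptyset$) choose $x_i\in\{x_1,\dots,x_k\}$; for each pair in $\mathscr{A}'$ Spoiler (re)assigns $x_i$ to an element, giving $\mathscr{A}''$; Duplicator, for each pair in $\mathscr{B}'$, may make any number of copies and (re)assigns $x_i$ to an element in each copy, giving $\mathscr{B}''$; Spoiler picks $r''$ with $h_\exists(r'')=r'$, and child $(\mathscr{A}'',\mathscr{B}'',r'')$ is created. (Pebble-Right, if $h_\forall^{-1}(r')\neq\emptyset$) dual, with $h_\forall(r'')=r'$. (Split-Left, if $h_\vee^{-1}(r')\ne\emptyset$) partition $\mathscr{A}'=\mathscr{A}'_1\cup\mathscr{A}'_2$, choose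 $r'_1,r'_2$ with $h_\vee(r'_1,r'_2)=r'$, children $(\mathscr{A}'_1,\mathscr{B}',r'_1)$, $(\mathscr{A}'_2,\mathscr{B}',r'_2)$. (Split-Right, if $h_\wedge^{-1}(r')\ne\emptyset$) dual with $h_\wedge$. (Swap, if $h_\neg^{-1}(r')\ne\emptyset$) choose $r''$ with $h_\neg(r'')=r'$, child $(\mathscr{B}',\mathscr{A}',r'')$. (Close) if some atomic formula $\varphi$ over $\tau$ (in $\mathrm{FO}^k(\tau)$) is separating for $(\mathscr{A}',\mathscr{B}')$ and $h_{\mathsf{atomic}}$ of its predicate equals $r'$, mark $X$ closed. Spoiler wins iff all leaves become closed. *)

theory Defs
  imports Main
begin

section \<open>First-order logic with finitely many variables\<close>

record ('r, 'c) vocabulary =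
  relsyms :: "'r set"
  arity :: "'r \<Rightarrow> nat"
  consyms :: "'c set"

definition finite_vocabulary :: "('r, 'c) vocabulary \<Rightarrow> bool" where
  "finite_vocabulary \<tau> \<longleftrightarrow> finite (relsyms \<tau>) \<and> finite (consyms \<tau>)"

datatype 'r pred = Equality | Rel 'r

definition Pred :: "('r, 'c) vocabulary \<Rightarrow> 'r pred set" where
  "Pred \<tau> = insert Equality (Rel ` relsyms \<tau>)"

primrec pred_arity :: "('r, 'c) vocabulary \<Rightarrow> 'r pred \<Rightarrow> nat" where
  "pred_arity \<tau> Equality = 2"
| "pred_arity \<tau> (Rel R) = arity \<tau> R"

datatype 'c trm = Var nat | Const 'c

datatype ('r, 'c) fm =
    Atom "'r pred" "'c trm list"
  | Neg "('r, 'c) fm"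
  | Or "('r, 'c) fm" "('r, 'c) fm"
  | And "('r, 'c) fm" "('r, 'c) fm"
  | Ex nat "('r, 'c) fm"
  | All nat "('r, 'c) fm"

text \<open>The variable \<open>x\<^sub>i\<close> is represented by its index \<open>i\<close>.\<close>

definition vars :: "nat \<Rightarrow> nat set" where
  "vars k = {1..k}"

primrec wf_trm :: "('r, 'c) vocabulary \<Rightarrow> nat \<Rightarrow> 'c trm \<Rightarrow> bool" where
  "wf_trm \<tau> k (Var x) \<longleftrightarrow> x \<in> vars k"
| "wf_trm \<tau> k (Const c) \<longleftrightarrow> c \<in> consyms \<tau>"

primrec wf_fm :: "('r, 'c) vocabulary \<Rightarrow> nat \<Rightarrow> ('r, 'c) fm \<Rightarrow> bool" where
  "wf_fm \<tau> k (Atom P ts) \<longleftrightarrow>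
     P \<in> Pred \<tau> \<and> length ts = pred_arity \<tau> P \<and> (\<forall>t \<in> set ts. wf_trm \<tau> k t)"
| "wf_fm \<tau> k (Neg \<psi>) \<longleftrightarrow> wf_fm \<tau> k \<psi>"
| "wf_fm \<tau> k (Or \<psi> \<gamma>) \<longleftrightarrow> wf_fm \<tau> k \<psi> \<and> wf_fm \<tau> k \<gamma>"
| "wf_fm \<tau> k (And \<psi> \<gamma>) \<longleftrightarrow> wf_fm \<tau> k \<psi> \<and> wf_fm \<tau> k \<gamma>"
| "wf_fm \<tau> k (Ex x \<psi>) \<longleftrightarrow> x \<in> vars k \<and> wf_fm \<tau> k \<psi>"
| "wf_fm \<tau> k (All x \<psi>) \<longleftrightarrow> x \<in> vars k \<and> wf_fm \<tau> k \<psi>"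

definition FO :: "('r, 'c) vocabulary \<Rightarrow> nat \<Rightarrow> ('r, 'c) fm set" where
  "FO \<tau> k = {\<phi>. wf_fm \<tau> k \<phi>}"

primrec trm_vars :: "'c trm \<Rightarrow> nat set" where
  "trm_vars (Var x) = {x}"
| "trm_vars (Const c) = {}"

primrec Free :: "('r, 'c) fm \<Rightarrow> nat set" where
  "Free (Atom P ts) = (\<Union>t \<in> set ts. trm_vars t)"
| "Free (Neg \<psi>) = Free \<psi>"
| "Free (Or \<psi> \<gamma>) = Free \<psi> \<union> Free \<gamma>"
| "Free (And \<psi> \<gamma>) = Free \<psi> \<union> Free \<gamma>"
| "Free (Ex x \<psi>) = Free \<psi> - {x}"
| "Free (All x \<psi>) = Free \<psi> - {x}"


section \<open>Structure-assignment pairs\<close>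

record ('r, 'c, 'a) fostruct =
  univ :: "'a set"
  rel :: "'r \<Rightarrow> 'a list set"
  con :: "'c \<Rightarrow> 'a"

type_synonym ('r, 'c, 'a) sapair = "('r, 'c, 'a) fostruct \<times> (nat \<rightharpoonup> 'a)"

definition is_structure :: "('r, 'c) vocabulary \<Rightarrow> ('r, 'c, 'a) fostruct \<Rightarrow> bool" where
  "is_structure \<tau> A \<longleftrightarrow>
     univ A \<noteq> {} \<and>
     (\<forall>R \<in> relsyms \<tau>. rel A R \<subseteq> {as. length as = arity \<tau> R \<and> set as \<subseteq> univ A}) \<and>
     (\<forall>c \<in> consyms \<tau>. con A c \<in> univ A)"

definition is_sapair :: "('r, 'c) vocabulary \<Rightarrow> ('r, 'c, 'a) sapair \<Rightarrow> bool" where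
  "is_sapair \<tau> = (\<lambda>(A, \<alpha>). is_structure \<tau> A \<and> ran \<alpha> \<subseteq> univ A)"

primrec interp :: "('r, 'c, 'a) fostruct \<Rightarrow> 'r pred \<Rightarrow> 'a list set" where
  "interp A Equality = {[a, a] | a. a \<in> univ A}"
| "interp A (Rel R) = rel A R"

primrec val :: "('r, 'c, 'a) fostruct \<Rightarrow> (nat \<rightharpoonup> 'a) \<Rightarrow> 'c trm \<Rightarrow> 'a" where
  "val A \<alpha> (Var x) = the (\<alpha> x)"
| "val A \<alpha> (Const c) = con A c"

text \<open>Satisfaction is meaningful only for formulas whose free variables lie in the
  domain of the assignment; \<open>separating\<close> below imposes this.\<close>

primrec sat :: "('r, 'c, 'a) fostruct \<Rightarrow> (nat \<rightharpoonup> 'a) \<Rightarrow> ('r, 'c) fm \<Rightarrow> bool" where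
  "sat A \<alpha> (Atom P ts) \<longleftrightarrow> map (val A \<alpha>) ts \<in> interp A P"
| "sat A \<alpha> (Neg \<psi>) \<longleftrightarrow> \<not> sat A \<alpha> \<psi>"
| "sat A \<alpha> (Or \<psi> \<gamma>) \<longleftrightarrow> sat A \<alpha> \<psi> \<or> sat A \<alpha> \<gamma>"
| "sat A \<alpha> (And \<psi> \<gamma>) \<longleftrightarrow> sat A \<alpha> \<psi> \<and> sat A \<alpha> \<gamma>"
| "sat A \<alpha> (Ex x \<psi>) \<longleftrightarrow> (\<exists>a \<in> univ A. sat A (\<alpha>(x \<mapsto> a)) \<psi>)"
| "sat A \<alpha> (All x \<psi>) \<longleftrightarrow> (\<forall>a \<in> univ A. sat A (\<alpha>(x \<mapsto> a)) \<psi>)"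

text \<open>The common domain \<open>V\<close> is an explicit parameter. It is determined by \<open>\<A>\<close> and \<open>\<B>\<close>
  unless both are empty. Games do reach nodes with two empty sides (by splitting when one
  side is empty), and there the variables that carry pebbles still have to be known.\<close>

definition domain_consistent ::
  "('r, 'c) vocabulary \<Rightarrow> nat set \<Rightarrow> ('r, 'c, 'a) sapair set \<Rightarrow> ('r, 'c, 'a) sapair set \<Rightarrow> bool"
where
  "domain_consistent \<tau> V \<A> \<B> \<longleftrightarrow>
     (\<forall>(A, \<alpha>) \<in> \<A> \<union> \<B>. is_sapair \<tau> (A, \<alpha>) \<and> dom \<alpha> = V)"

definition separating ::
  "nat set \<Rightarrow> ('r, 'c, 'a) sapair set \<Rightarrow> ('r, 'c, 'a) sapair set \<Rightarrow> ('r, 'c) fm \<Rightarrow> bool"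
where
  "separating V \<A> \<B> \<psi> \<longleftrightarrow>
     Free \<psi> \<subseteq> V \<and> (\<forall>(A, \<alpha>) \<in> \<A>. sat A \<alpha> \<psi>) \<and> (\<forall>(B, \<beta>) \<in> \<B>. sat B \<beta> (Neg \<psi>))"


section \<open>Compositional syntactic measures\<close>

record 'r measure_funs =
  h_atomic :: "'r pred \<Rightarrow> nat"
  h_neg :: "nat \<Rightarrow> nat"
  h_or :: "nat \<Rightarrow> nat \<Rightarrow> nat"
  h_and :: "nat \<Rightarrow> nat \<Rightarrow> nat"
  h_ex :: "nat \<Rightarrow> nat"
  h_all :: "nat \<Rightarrow> nat"

definition compositional_measure ::
  "('r, 'c) vocabulary \<Rightarrow> nat \<Rightarrow> 'r measure_funs \<Rightarrow> (('r, 'c) fm \<Rightarrow> nat) \<Rightarrow> bool"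
where
  "compositional_measure \<tau> k h f \<longleftrightarrow>
     (\<forall>P ts. Atom P ts \<in> FO \<tau> k \<longrightarrow> f (Atom P ts) = h_atomic h P) \<and>
     (\<forall>\<psi> \<in> FO \<tau> k. f (Neg \<psi>) = h_neg h (f \<psi>)) \<and>
     (\<forall>\<psi> \<in> FO \<tau> k. \<forall>\<gamma> \<in> FO \<tau> k. f (Or \<psi> \<gamma>) = h_or h (f \<psi>) (f \<gamma>)) \<and>
     (\<forall>\<psi> \<in> FO \<tau> k. \<forall>\<gamma> \<in> FO \<tau> k. f (And \<psi> \<gamma>) = h_and h (f \<psi>) (f \<gamma>)) \<and>
     (\<forall>x \<in> vars k. \<forall>\<psi> \<in> FO \<tau> k. f (Ex x \<psi>) = h_ex h (f \<psi>)) \<and>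
     (\<forall>x \<in> vars k. \<forall>\<psi> \<in> FO \<tau> k. f (All x \<psi>) = h_all h (f \<psi>))"


section \<open>The game\<close>

text \<open>A node \<open>(V, \<A>, \<B>, r)\<close> is the triple \<open>(\<A>, \<B>, r)\<close> together with the common
  domain \<open>V\<close> of the assignments.\<close>

type_synonym ('r, 'c, 'a) node =
  "nat set \<times> ('r, 'c, 'a) sapair set \<times> ('r, 'c, 'a) sapair set \<times> nat"

datatype 'n gtree = Open 'n | Closed 'n | Branch 'n "'n gtree list"

primrec all_closed :: "'n gtree \<Rightarrow> bool" where
  "all_closed (Open X) \<longleftrightarrow> False"
| "all_closed (Closed X) \<longleftrightarrow> True"
| "all_closed (Branch X ts) \<longleftrightarrow> list_all all_closed ts"

text \<open>Leaves are addressed by the list of child indices leading to them from the root.\<close>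

fun open_leaf :: "nat list \<Rightarrow> 'n gtree \<Rightarrow> 'n option" where
  "open_leaf [] (Open X) = Some X"
| "open_leaf (j # p) (Branch X ts) = (if j < length ts then open_leaf p (ts ! j) else None)"
| "open_leaf _ _ = None"

fun graft :: "nat list \<Rightarrow> 'n gtree \<Rightarrow> 'n gtree \<Rightarrow> 'n gtree" where
  "graft [] s t = s"
| "graft (j # p) s (Branch X ts) = Branch X (ts[j := graft p s (ts ! j)])"
| "graft (j # p) s t = t"

definition valid_placement ::
  "('r, 'c, 'a) sapair set \<Rightarrow> (('r, 'c, 'a) sapair \<Rightarrow> 'a) \<Rightarrow> bool"
where
  "valid_placement \<A> s \<longleftrightarrow> (\<forall>(A, \<alpha>) \<in> \<A>. s (A, \<alpha>) \<in> univ A)"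

definition place ::
  "nat \<Rightarrow> (('r, 'c, 'a) sapair \<Rightarrow> 'a) \<Rightarrow> ('r, 'c, 'a) sapair set \<Rightarrow> ('r, 'c, 'a) sapair set"
where
  "place i s \<A> = {(A, \<alpha>(i \<mapsto> s (A, \<alpha>))) | A \<alpha>. (A, \<alpha>) \<in> \<A>}"

text \<open>The possible results of Duplicator's reply. \<open>D (B, \<beta>)\<close> is the set of elements that
  \<open>x\<^sub>i\<close> is assigned to in the copies made of \<open>(B, \<beta>)\<close>; there is at least one copy.\<close>

definition replies :: "nat \<Rightarrow> ('r, 'c, 'a) sapair set \<Rightarrow> ('r, 'c, 'a) sapair set set" where
  "replies i \<B> =
     {{(B, \<beta>(i \<mapsto> b)) | B \<beta> b. (B, \<beta>) \<in> \<B> \<and> b \<in> D (B, \<beta>)} | D.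
       \<forall>(B, \<beta>) \<in> \<B>. D (B, \<beta>) \<noteq> {} \<and> D (B, \<beta>) \<subseteq> univ B}"

text \<open>In a pebble move the last component is Spoiler's choice of the new counter. It is a
  function of the result of Duplicator's reply, since it is made after that reply.\<close>

datatype ('r, 'c, 'a) action =
    Pebble_Left nat "('r, 'c, 'a) sapair \<Rightarrow> 'a" "('r, 'c, 'a) sapair set \<Rightarrow> nat"
  | Pebble_Right nat "('r, 'c, 'a) sapair \<Rightarrow> 'a" "('r, 'c, 'a) sapair set \<Rightarrow> nat"
  | Split_Left "('r, 'c, 'a) sapair set" "('r, 'c, 'a) sapair set" nat nat
  | Split_Right "('r, 'c, 'a) sapair set" "('r, 'c, 'a) sapair set" nat nat
  | Swap nat
  | Close

fun legal ::
  "('r, 'c) vocabulary \<Rightarrow> nat \<Rightarrow> 'r measure_funs \<Rightarrow>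
   ('r, 'c, 'a) node \<Rightarrow> ('r, 'c, 'a) action \<Rightarrow> bool"
where
  "legal \<tau> k h (V, \<A>, \<B>, r) (Pebble_Left i s g) \<longleftrightarrow>
     (\<exists>q. h_ex h q = r) \<and> i \<in> vars k \<and> valid_placement \<A> s \<and>
     (\<forall>\<B>' \<in> replies i \<B>. h_ex h (g \<B>') = r)"
| "legal \<tau> k h (V, \<A>, \<B>, r) (Pebble_Right i s g) \<longleftrightarrow>
     (\<exists>q. h_all h q = r) \<and> i \<in> vars k \<and> valid_placement \<B> s \<and>
     (\<forall>\<A>' \<in> replies i \<A>. h_all h (g \<A>') = r)"
| "legal \<tau> k h (V, \<A>, \<B>, r) (Split_Left \<A>1 \<A>2 r1 r2) \<longleftrightarrow>
     \<A>1 \<union> \<A>2 = \<A> \<and> \<A>1 \<inter> \<A>2 = {} \<and> h_or h r1 r2 = r"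
| "legal \<tau> k h (V, \<A>, \<B>, r) (Split_Right \<B>1 \<B>2 r1 r2) \<longleftrightarrow>
     \<B>1 \<union> \<B>2 = \<B> \<and> \<B>1 \<inter> \<B>2 = {} \<and> h_and h r1 r2 = r"
| "legal \<tau> k h (V, \<A>, \<B>, r) (Swap q) \<longleftrightarrow> h_neg h q = r"
| "legal \<tau> k h (V, \<A>, \<B>, r) Close \<longleftrightarrow>
     (\<exists>P ts. Atom P ts \<in> FO \<tau> k \<and> separating V \<A> \<B> (Atom P ts) \<and> h_atomic h P = r)"

text \<open>The subtrees that may replace an open leaf after a move of Spoiler, one for each
  result of a reply of Duplicator.\<close>

fun outcomes ::
  "('r, 'c, 'a) node \<Rightarrow> ('r, 'c, 'a) action \<Rightarrow> ('r, 'c, 'a) node gtree set"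
where
  "outcomes (V, \<A>, \<B>, r) (Pebble_Left i s g) =
     {Branch (V, \<A>, \<B>, r) [Open (insert i V, place i s \<A>, \<B>', g \<B>')] | \<B>'. \<B>' \<in> replies i \<B>}"
| "outcomes (V, \<A>, \<B>, r) (Pebble_Right i s g) =
     {Branch (V, \<A>, \<B>, r) [Open (insert i V, \<A>', place i s \<B>, g \<A>')] | \<A>'. \<A>' \<in> replies i \<A>}"
| "outcomes (V, \<A>, \<B>, r) (Split_Left \<A>1 \<A>2 r1 r2) =
     {Branch (V, \<A>, \<B>, r) [Open (V, \<A>1, \<B>, r1), Open (V, \<A>2, \<B>, r2)]}"
| "outcomes (V, \<A>, \<B>, r) (Split_Right \<B>1 \<B>2 r1 r2) =
     {Branch (V, \<A>, \<B>, r) [Open (V, \<A>, \<B>1, r1), Open (V, \<A>, \<B>2, r2)]}"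
| "outcomes (V, \<A>, \<B>, r) (Swap q) = {Branch (V, \<A>, \<B>, r) [Open (V, \<B>, \<A>, q)]}"
| "outcomes (V, \<A>, \<B>, r) Close = {Closed (V, \<A>, \<B>, r)}"

text \<open>A strategy maps the chronological list of trees seen so far to the address of an open
  leaf and a move on it.\<close>

type_synonym ('r, 'c, 'a) strategy =
  "('r, 'c, 'a) node gtree list \<Rightarrow> nat list \<times> ('r, 'c, 'a) action"

definition legal_at ::
  "('r, 'c) vocabulary \<Rightarrow> nat \<Rightarrow> 'r measure_funs \<Rightarrow>
   ('r, 'c, 'a) node gtree \<Rightarrow> nat list \<times> ('r, 'c, 'a) action \<Rightarrow> bool"
where
  "legal_at \<tau> k h T = (\<lambda>(p, m). \<exists>X. open_leaf p T = Some X \<and> legal \<tau> k h X m)"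

definition next_trees ::
  "('r, 'c, 'a) node gtree \<Rightarrow> nat list \<times> ('r, 'c, 'a) action \<Rightarrow> ('r, 'c, 'a) node gtree set"
where
  "next_trees T = (\<lambda>(p, m). {graft p s T | s X. open_leaf p T = Some X \<and> s \<in> outcomes X m})"

inductive partial_play ::
  "('r, 'c, 'a) node \<Rightarrow> ('r, 'c, 'a) strategy \<Rightarrow> ('r, 'c, 'a) node gtree list \<Rightarrow> bool"
  for X0 :: "('r, 'c, 'a) node" and \<sigma> :: "('r, 'c, 'a) strategy"
where
  start: "partial_play X0 \<sigma> [Open X0]"
| step: "partial_play X0 \<sigma> H \<Longrightarrow> \<not> all_closed (last H) \<Longrightarrow> T \<in> next_trees (last H) (\<sigma> H)
    \<Longrightarrow> partial_play X0 \<sigma> (H @ [T])"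

text \<open>Spoiler has to close all leaves after finitely many moves: as long as some leaf is open
  the strategy prescribes a legal move, and no play goes on forever.\<close>

definition winning_strategy ::
  "('r, 'c) vocabulary \<Rightarrow> nat \<Rightarrow> 'r measure_funs \<Rightarrow>
   ('r, 'c, 'a) node \<Rightarrow> ('r, 'c, 'a) strategy \<Rightarrow> bool"
where
  "winning_strategy \<tau> k h X0 \<sigma> \<longleftrightarrow>
     (\<forall>H. partial_play X0 \<sigma> H \<and> \<not> all_closed (last H) \<longrightarrow> legal_at \<tau> k h (last H) (\<sigma> H)) \<and>
     \<not> (\<exists>T. \<forall>n. partial_play X0 \<sigma> (map T [0..<Suc n]))"

definition spoiler_wins_SG ::
  "('r, 'c) vocabulary \<Rightarrow> nat \<Rightarrow> nat \<Rightarrow> 'r measure_funs \<Rightarrow> nat set \<Rightarrow>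
   ('r, 'c, 'a) sapair set \<Rightarrow> ('r, 'c, 'a) sapair set \<Rightarrow> bool"
where
  "spoiler_wins_SG \<tau> r k h V \<A> \<B> \<longleftrightarrow> (\<exists>\<sigma>. winning_strategy \<tau> k h (V, \<A>, \<B>, r) \<sigma>)"

end

theory Submission
  imports Defs
begin

text \<open>
  A separating formula is a strategy: Spoiler plays its outermost connective on an open leaf, and
  the sum, over the open leaves, of the least sizes of separating formulas with the right measure
  decreases with every move. Conversely, if Duplicator always replies with all possible copies,
  then separating formulas for the children of a node combine to one for the node itself. So
  Duplicator can keep an open leaf without a separating formula forever if the root is one.
\<close>

section \<open>Open leaves of a game tree and their change under a move\<close>

text \<open>A list rather than a set: equal nodes may sit at several leaves, and each occurrence has
  to count when ranks are summed.\<close>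

primrec open_nodes :: "'n gtree \<Rightarrow> 'n list" where
  "open_nodes (Open X) = [X]"
| "open_nodes (Closed X) = []"
| "open_nodes (Branch X ts) = concat (map open_nodes ts)"

lemma all_closed_iff_open_nodes: "all_closed T \<longleftrightarrow> open_nodes T = []"
  by (induction T) (auto simp: list_all_iff)

lemma open_nodes_imp_open_leaf:
  "X \<in> set (open_nodes T) \<Longrightarrow> \<exists>p. open_leaf p T = Some X"
proof (induction T)
  case (Open Y)
  then show ?case by (intro exI[of _ "[]"]) simp
next
  case (Branch Y ts)
  then obtain j p where "j < length ts" "open_leaf p (ts ! j) = Some X"
    by (auto simp: in_set_conv_nth) metis
  then show ?case by (intro exI[of _ "j # p"]) simp
qed simp

text \<open>Grafting at an open leaf touches nothing outside that leaf. The order of quantifiers is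
  what matters: \<open>ls\<close> and \<open>rs\<close> are fixed before \<open>s\<close>, so all
  outcomes of a move can be compared with the old tree through one decomposition.\<close>

lemma open_nodes_graft:
  assumes "open_leaf p T = Some X"
  shows "\<exists>ls rs. open_nodes T = ls @ X # rs \<and>
    (\<forall>s. open_nodes (graft p s T) = ls @ open_nodes s @ rs)"
  using assms
proof (induction p T rule: open_leaf.induct)
  case (1 Y)
  then show ?case by (intro exI[of _ "[]"]) simp
next
  case (2 j p Y ts)
  then have j: "j < length ts" and "open_leaf p (ts ! j) = Some X"
    by (auto split: if_splits)
  with 2 obtain ls rs where IH: "open_nodes (ts ! j) = ls @ X # rs"
    "\<And>s. open_nodes (graft p s (ts ! j)) = ls @ open_nodes s @ rs"
    by blast
  let ?before = "concat (map open_nodes (take j ts))"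
  let ?after = "concat (map open_nodes (drop (Suc j) ts))"
  have "open_nodes (Branch Y ts) = (?before @ ls) @ X # (rs @ ?after)"
    by (subst id_take_nth_drop[OF j]) (simp add: IH(1))
  moreover have "open_nodes (graft (j # p) s (Branch Y ts))
      = (?before @ ls) @ open_nodes s @ (rs @ ?after)" for s
    using j by (simp add: upd_conv_take_nth_drop IH(2))
  ultimately show ?case by blast
qed auto

section \<open>Separating formulas of a node and their least size\<close>

text \<open>The measure \<open>f\<close> cannot bound the length of a play, because the functions in
  \<open>h\<close> are arbitrary and need not grow from a subformula to the formula. This size does
  grow strictly.\<close>

primrec fm_size :: "('r, 'c) fm \<Rightarrow> nat" where
  "fm_size (Atom P ts) = 1"
| "fm_size (Neg \<psi>) = Suc (fm_size \<psi>)"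
| "fm_size (Or \<psi> \<gamma>) = Suc (fm_size \<psi> + fm_size \<gamma>)"
| "fm_size (And \<psi> \<gamma>) = Suc (fm_size \<psi> + fm_size \<gamma>)"
| "fm_size (Ex x \<psi>) = Suc (fm_size \<psi>)"
| "fm_size (All x \<psi>) = Suc (fm_size \<psi>)"

definition consistent_node :: "('r, 'c) vocabulary \<Rightarrow> ('r, 'c, 'a) node \<Rightarrow> bool" where
  "consistent_node \<tau> = (\<lambda>(V, \<A>, \<B>, r). domain_consistent \<tau> V \<A> \<B>)"

definition node_formulas ::
  "('r, 'c) vocabulary \<Rightarrow> nat \<Rightarrow> (('r, 'c) fm \<Rightarrow> nat) \<Rightarrow> ('r, 'c, 'a) node \<Rightarrow> ('r, 'c) fm set"
where
  "node_formulas \<tau> k f = (\<lambda>(V, \<A>, \<B>, r). {\<phi> \<in> FO \<tau> k. f \<phi> = r \<and> separating V \<A> \<B> \<phi>})"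

text \<open>Informative only if the node has a separating formula with the right measure; otherwise
  \<open>LEAST\<close> ranges over an empty set and its value is unspecified.\<close>

definition node_rank ::
  "('r, 'c) vocabulary \<Rightarrow> nat \<Rightarrow> (('r, 'c) fm \<Rightarrow> nat) \<Rightarrow> ('r, 'c, 'a) node \<Rightarrow> nat"
where
  "node_rank \<tau> k f X = (LEAST n. n \<in> fm_size ` node_formulas \<tau> k f X)"

lemma node_rank_le: "\<phi> \<in> node_formulas \<tau> k f X \<Longrightarrow> node_rank \<tau> k f X \<le> fm_size \<phi>"
  unfolding node_rank_def by (intro Least_le) auto

lemma node_rank_attained:
  assumes "node_formulas \<tau> k f X \<noteq> {}"
  shows "\<exists>\<phi> \<in> node_formulas \<tau> k f X. fm_size \<phi> = node_rank \<tau> k f X"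
proof -
  have "node_rank \<tau> k f X \<in> fm_size ` node_formulas \<tau> k f X"
    unfolding node_rank_def by (rule LeastI_ex) (use assms in auto)
  then show ?thesis by force
qed

lemma FO_simps [simp]:
  "Neg \<psi> \<in> FO \<tau> k \<longleftrightarrow> \<psi> \<in> FO \<tau> k"
  "Or \<psi> \<gamma> \<in> FO \<tau> k \<longleftrightarrow> \<psi> \<in> FO \<tau> k \<and> \<gamma> \<in> FO \<tau> k"
  "And \<psi> \<gamma> \<in> FO \<tau> k \<longleftrightarrow> \<psi> \<in> FO \<tau> k \<and> \<gamma> \<in> FO \<tau> k"
  "Ex x \<psi> \<in> FO \<tau> k \<longleftrightarrow> x \<in> vars k \<and> \<psi> \<in> FO \<tau> k"
  "All x \<psi> \<in> FO \<tau> k \<longleftrightarrow> x \<in> vars k \<and> \<psi> \<in> FO \<tau> k"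
  by (auto simp: FO_def)

lemma measure_simps:
  assumes "compositional_measure \<tau> k h f"
  shows "Atom P ts \<in> FO \<tau> k \<Longrightarrow> f (Atom P ts) = h_atomic h P"
    and "\<psi> \<in> FO \<tau> k \<Longrightarrow> f (Neg \<psi>) = h_neg h (f \<psi>)"
    and "\<psi> \<in> FO \<tau> k \<Longrightarrow> \<gamma> \<in> FO \<tau> k \<Longrightarrow> f (Or \<psi> \<gamma>) = h_or h (f \<psi>) (f \<gamma>)"
    and "\<psi> \<in> FO \<tau> k \<Longrightarrow> \<gamma> \<in> FO \<tau> k \<Longrightarrow> f (And \<psi> \<gamma>) = h_and h (f \<psi>) (f \<gamma>)"
    and "x \<in> vars k \<Longrightarrow> \<psi> \<in> FO \<tau> k \<Longrightarrow> f (Ex x \<psi>) = h_ex h (f \<psi>)"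
    and "x \<in> vars k \<Longrightarrow> \<psi> \<in> FO \<tau> k \<Longrightarrow> f (All x \<psi>) = h_all h (f \<psi>)"
  using assms unfolding compositional_measure_def by blast+

section \<open>From a separating formula to a winning strategy\<close>

lemma separating_swap: "separating V \<A> \<B> (Neg \<psi>) \<longleftrightarrow> separating V \<B> \<A> \<psi>"
  by (auto simp: separating_def)

text \<open>Spoiler pebbles a witness of the existential formula in every left pair. On the right no
  element is a witness, so every copy refutes \<psi> whatever Duplicator replies; hence one
  placement \<open>s\<close> serves all replies.\<close>

lemma separating_Ex:
  fixes \<A> \<B> :: "('r, 'c, 'a) sapair set"
  assumes "separating V \<A> \<B> (Ex i \<psi>)"
  obtains s :: "('r, 'c, 'a) sapair \<Rightarrow> 'a" where "valid_placement \<A> s"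
    and "\<And>\<B>'. \<B>' \<in> replies i \<B> \<Longrightarrow> separating (insert i V) (place i s \<A>) \<B>' \<psi>"
proof
  define s :: "('r, 'c, 'a) sapair \<Rightarrow> 'a"
    where "s = (\<lambda>(A, \<alpha>). SOME a. a \<in> univ A \<and> sat A (\<alpha>(i \<mapsto> a)) \<psi>)"
  have s: "s (A, \<alpha>) \<in> univ A \<and> sat A (\<alpha>(i \<mapsto> s (A, \<alpha>))) \<psi>" if "(A, \<alpha>) \<in> \<A>" for A \<alpha>
  proof -
    have "\<exists>a. a \<in> univ A \<and> sat A (\<alpha>(i \<mapsto> a)) \<psi>"
      using assms that by (auto simp: separating_def)
    then show ?thesis unfolding s_def prod.case by (rule someI_ex)
  qed
  then show "valid_placement \<A> s" by (auto simp: valid_placement_def)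
  show "separating (insert i V) (place i s \<A>) \<B>' \<psi>" if \<B>': "\<B>' \<in> replies i \<B>" for \<B>'
  proof -
    obtain D where D: "\<B>' = {(B, \<beta>(i \<mapsto> b)) | B \<beta> b. (B, \<beta>) \<in> \<B> \<and> b \<in> D (B, \<beta>)}"
      "\<forall>(B, \<beta>) \<in> \<B>. D (B, \<beta>) \<noteq> {} \<and> D (B, \<beta>) \<subseteq> univ B"
      using \<B>' by (auto simp: replies_def)
    have "sat A \<alpha> \<psi>" if "(A, \<alpha>) \<in> place i s \<A>" for A \<alpha>
      using that s by (auto simp: place_def)
    moreover have "\<not> sat B \<beta> \<psi>" if B: "(B, \<beta>) \<in> \<B>'" for B \<beta>
    proof -
      obtain \<beta>' b where "(B, \<beta>') \<in> \<B>" "b \<in> univ B" "\<beta> = \<beta>'(i \<mapsto> b)"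
        using B D by auto blast
      then show ?thesis using assms by (auto simp: separating_def)
    qed
    moreover have "Free \<psi> \<subseteq> insert i V" using assms by (auto simp: separating_def)
    ultimately show ?thesis by (auto simp: separating_def)
  qed
qed

text \<open>Dual to \<open>separating_Ex\<close>: exchange the two sides and read the universal
  formula as a negated existential one.\<close>

lemma separating_All:
  assumes "separating V \<A> \<B> (All i \<psi>)"
  obtains s where "valid_placement \<B> s"
    and "\<And>\<A>'. \<A>' \<in> replies i \<A> \<Longrightarrow> separating (insert i V) \<A>' (place i s \<B>) \<psi>"
proof -
  have "separating V \<B> \<A> (Ex i (Neg \<psi>))"
    using assms by (auto simp: separating_def)
  then obtain s where "valid_placement \<B> s"
    and "\<And>\<A>'. \<A>' \<in> replies i \<A> \<Longrightarrow> separating (insert i V) (place i s \<B>) \<A>' (Neg \<psi>)"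
    using separating_Ex by blast
  with that show ?thesis by (simp add: separating_swap)
qed

text \<open>Take a separating formula of least size and play its outermost connective. Its immediate
  subformulas separate the new leaves, so the ranks of these leaves sum to at most the sizes of the
  subformulas, which is less than the size of the formula.\<close>

lemma move_from_formula:
  assumes f: "compositional_measure \<tau> k h f"
    and X: "node_formulas \<tau> k f X \<noteq> {}"
  shows "\<exists>m. legal \<tau> k h X m \<and> (\<forall>t \<in> outcomes X m.
    (\<forall>Y \<in> set (open_nodes t). node_formulas \<tau> k f Y \<noteq> {}) \<and>
    sum_list (map (node_rank \<tau> k f) (open_nodes t)) < node_rank \<tau> k f X)"
proof -
  obtain V \<A> \<B> r where X_eq: "X = (V, \<A>, \<B>, r)" by (cases X)
  obtain \<phi> where \<phi>: "\<phi> \<in> FO \<tau> k" "f \<phi> = r" "separating V \<A> \<B> \<phi>"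
    and rank: "fm_size \<phi> = node_rank \<tau> k f X"
    using node_rank_attained[OF X] by (auto simp: X_eq node_formulas_def)
  \<comment> \<open>Only an upper bound: a child may have a smaller separating formula than the
    subformula inherited from its parent.\<close>
  have child: "node_formulas \<tau> k f (V', \<A>', \<B>', f \<psi>) \<noteq> {} \<and>
      node_rank \<tau> k f (V', \<A>', \<B>', f \<psi>) \<le> fm_size \<psi>"
    if "\<psi> \<in> FO \<tau> k" "separating V' \<A>' \<B>' \<psi>" for V' \<A>' \<B>' \<psi>
  proof -
    have "\<psi> \<in> node_formulas \<tau> k f (V', \<A>', \<B>', f \<psi>)"
      using that by (simp add: node_formulas_def)
    then show ?thesis using node_rank_le by blast
  qed
  note fs = measure_simps[OF f]
  show ?thesis
  proof (cases \<phi>)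
    case (Atom P ts)
    \<comment> \<open>A closed leaf contributes no open nodes, so the sum is 0; the inequality is
      strict because an atom has size 1.\<close>
    with \<phi> rank fs(1) show ?thesis by (intro exI[of _ Close]) (auto simp: X_eq)
  next
    case (Neg \<psi>)
    with \<phi> have "separating V \<B> \<A> \<psi>" "\<psi> \<in> FO \<tau> k" by (auto simp: separating_swap)
    with Neg \<phi> rank fs(2) child[of \<psi> V \<B> \<A>] show ?thesis
      by (intro exI[of _ "Swap (f \<psi>)"]) (auto simp: X_eq)
  next
    case (Or \<psi> \<gamma>)
    \<comment> \<open>Pairs satisfying the first disjunct go to the first child. The remaining ones
      satisfy the second, and the right side refutes both.\<close>
    define \<A>1 where "\<A>1 = {(A, \<alpha>) \<in> \<A>. sat A \<alpha> \<psi>}"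
    have "separating V \<A>1 \<B> \<psi>" "separating V (\<A> - \<A>1) \<B> \<gamma>"
      using \<phi>(3) by (auto simp: Or separating_def \<A>1_def)
    with child[of \<psi> V \<A>1 \<B>] child[of \<gamma> V "\<A> - \<A>1" \<B>] Or \<phi>
    have "node_formulas \<tau> k f (V, \<A>1, \<B>, f \<psi>) \<noteq> {}"
      "node_rank \<tau> k f (V, \<A>1, \<B>, f \<psi>) \<le> fm_size \<psi>"
      "node_formulas \<tau> k f (V, \<A> - \<A>1, \<B>, f \<gamma>) \<noteq> {}"
      "node_rank \<tau> k f (V, \<A> - \<A>1, \<B>, f \<gamma>) \<le> fm_size \<gamma>"
      by auto
    moreover have "\<A>1 \<subseteq> \<A>" by (auto simp: \<A>1_def)
    ultimately show ?thesis using Or \<phi> rank fs(3)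
      by (intro exI[of _ "Split_Left \<A>1 (\<A> - \<A>1) (f \<psi>) (f \<gamma>)"]) (auto simp: X_eq)
  next
    case (And \<psi> \<gamma>)
    \<comment> \<open>Here the right side is divided, by whether the first conjunct already
      fails.\<close>
    define \<B>1 where "\<B>1 = {(B, \<beta>) \<in> \<B>. \<not> sat B \<beta> \<psi>}"
    have "separating V \<A> \<B>1 \<psi>" "separating V \<A> (\<B> - \<B>1) \<gamma>"
      using \<phi>(3) by (auto simp: And separating_def \<B>1_def)
    with child[of \<psi> V \<A> \<B>1] child[of \<gamma> V \<A> "\<B> - \<B>1"] And \<phi>
    have "node_formulas \<tau> k f (V, \<A>, \<B>1, f \<psi>) \<noteq> {}"
      "node_rank \<tau> k f (V, \<A>, \<B>1, f \<psi>) \<le> fm_size \<psi>"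
      "node_formulas \<tau> k f (V, \<A>, \<B> - \<B>1, f \<gamma>) \<noteq> {}"
      "node_rank \<tau> k f (V, \<A>, \<B> - \<B>1, f \<gamma>) \<le> fm_size \<gamma>"
      by auto
    moreover have "\<B>1 \<subseteq> \<B>" by (auto simp: \<B>1_def)
    ultimately show ?thesis using And \<phi> rank fs(4)
      by (intro exI[of _ "Split_Right \<B>1 (\<B> - \<B>1) (f \<psi>) (f \<gamma>)"]) (auto simp: X_eq)
  next
    case (Ex i \<psi>)
    with \<phi>(3) obtain s where s: "valid_placement \<A> s"
      "\<And>\<B>'. \<B>' \<in> replies i \<B> \<Longrightarrow> separating (insert i V) (place i s \<A>) \<B>' \<psi>"
      using separating_Ex by blast
    have "node_formulas \<tau> k f (insert i V, place i s \<A>, \<B>', f \<psi>) \<noteq> {} \<and>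
        node_rank \<tau> k f (insert i V, place i s \<A>, \<B>', f \<psi>) < node_rank \<tau> k f X"
      if "\<B>' \<in> replies i \<B>" for \<B>'
      using child[OF _ s(2)[OF that]] rank \<phi>(1) by (auto simp: Ex)
    with s(1) \<phi> fs(5) Ex show ?thesis
      \<comment> \<open>The new counter is the measure of the subformula, so it need not depend on
        Duplicator's reply.\<close>
      by (intro exI[of _ "Pebble_Left i s (\<lambda>_. f \<psi>)"]) (auto simp: X_eq)
  next
    case (All i \<psi>)
    with \<phi>(3) obtain s where s: "valid_placement \<B> s"
      "\<And>\<A>'. \<A>' \<in> replies i \<A> \<Longrightarrow> separating (insert i V) \<A>' (place i s \<B>) \<psi>"
      using separating_All by blast
    have "node_formulas \<tau> k f (insert i V, \<A>', place i s \<B>, f \<psi>) \<noteq> {} \<and>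
        node_rank \<tau> k f (insert i V, \<A>', place i s \<B>, f \<psi>) < node_rank \<tau> k f X"
      if "\<A>' \<in> replies i \<A>" for \<A>'
      using child[OF _ s(2)[OF that]] rank \<phi>(1) by (auto simp: All)
    with s(1) \<phi> fs(6) All show ?thesis
      by (intro exI[of _ "Pebble_Right i s (\<lambda>_. f \<psi>)"]) (auto simp: X_eq)
  qed
qed

text \<open>While every open leaf has a separating formula, some move keeps this true and lowers the
  sum of the ranks, whatever the reply. Such a move is always at hand, and the natural numbers have
  no infinite descent.\<close>

lemma winning_strategy_from_formula:
  fixes X0 :: "('r, 'c, 'a) node"
  assumes f: "compositional_measure \<tau> k h f"
    and X0: "node_formulas \<tau> k f X0 \<noteq> {}"
  shows "\<exists>\<sigma>. winning_strategy \<tau> k h X0 \<sigma>"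
proof -
  define solvable where
    "solvable T \<longleftrightarrow> (\<forall>Y \<in> set (open_nodes T). node_formulas \<tau> k f Y \<noteq> {})"
    for T :: "('r, 'c, 'a) node gtree"
  define potential where
    "potential T = sum_list (map (node_rank \<tau> k f) (open_nodes T))"
    for T :: "('r, 'c, 'a) node gtree"
  define good where "good T pm \<longleftrightarrow> legal_at \<tau> k h T pm \<and>
    (\<forall>T' \<in> next_trees T pm. solvable T' \<and> potential T' < potential T)" for T pm
  have ex_good: "\<exists>pm. good T pm" if T: "solvable T" "\<not> all_closed T" for T
  proof -
    obtain X where X: "X \<in> set (open_nodes T)"
      using T(2) by (cases "open_nodes T") (auto simp: all_closed_iff_open_nodes)
    then obtain p where p: "open_leaf p T = Some X"
      using open_nodes_imp_open_leaf by metis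
    have "node_formulas \<tau> k f X \<noteq> {}" using T(1) X by (simp add: solvable_def)
    then obtain m where m: "legal \<tau> k h X m" "\<And>t. t \<in> outcomes X m \<Longrightarrow>
        (\<forall>Y \<in> set (open_nodes t). node_formulas \<tau> k f Y \<noteq> {}) \<and>
        sum_list (map (node_rank \<tau> k f) (open_nodes t)) < node_rank \<tau> k f X"
      using move_from_formula[OF f] by blast
    obtain ls rs where graft: "open_nodes T = ls @ X # rs"
      "\<And>s. open_nodes (graft p s T) = ls @ open_nodes s @ rs"
      using open_nodes_graft[OF p] by blast
    have "solvable (graft p s T) \<and> potential (graft p s T) < potential T"
      if "s \<in> outcomes X m" for s
      using T(1) m(2)[OF that] by (auto simp: solvable_def potential_def graft)
    then have "\<forall>T' \<in> next_trees T (p, m). solvable T' \<and> potential T' < potential T"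
      using p by (auto simp: next_trees_def)
    moreover have "legal_at \<tau> k h T (p, m)"
      using p m(1) unfolding legal_at_def by blast
    ultimately have "good T (p, m)" by (simp add: good_def)
    then show ?thesis ..
  qed
  \<comment> \<open>The strategy looks only at the current tree, not at the earlier history.\<close>
  define \<sigma> where "\<sigma> H = (SOME pm. good (last H) pm)" for H
  have \<sigma>: "good (last H) (\<sigma> H)" if "solvable (last H)" "\<not> all_closed (last H)" for H
    unfolding \<sigma>_def by (rule someI_ex) (rule ex_good[OF that])
  have solv: "solvable (last H)" if "partial_play X0 \<sigma> H" for H
    using that
  proof induction
    case start
    then show ?case using X0 by (simp add: solvable_def)
  next
    case (step H T)
    then show ?case using \<sigma>[of H] by (auto simp: good_def)
  qed
  have "winning_strategy \<tau> k h X0 \<sigma>"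
    unfolding winning_strategy_def
  proof (intro conjI allI impI notI)
    fix H assume "partial_play X0 \<sigma> H \<and> \<not> all_closed (last H)"
    then show "legal_at \<tau> k h (last H) (\<sigma> H)"
      using \<sigma> solv unfolding good_def by blast
  next
    assume "\<exists>T. \<forall>n. partial_play X0 \<sigma> (map T [0..<Suc n])"
    then obtain T where T: "\<And>n. partial_play X0 \<sigma> (map T [0..<Suc n])" by blast
    have "potential (T (Suc n)) < potential (T n)" for n
    proof -
      \<comment> \<open>Splitting off the last tree leaves a nonempty prefix, so inversion of
        \<open>partial_play\<close> can only yield its \<open>step\<close> rule.\<close>
      have "map T [0..<Suc (Suc n)] = map T [0..<Suc n] @ [T (Suc n)]" by simp
      then have "partial_play X0 \<sigma> (map T [0..<Suc n] @ [T (Suc n)])" using T by metis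
      then have "\<not> all_closed (T n) \<and> T (Suc n) \<in> next_trees (T n) (\<sigma> (map T [0..<Suc n]))"
        by (cases rule: partial_play.cases) auto
      then show ?thesis
        using \<sigma>[of "map T [0..<Suc n]"] solv[OF T[of n]] by (auto simp: good_def)
    qed
    then show False
      using wf_iff_no_infinite_down_chain[THEN iffD1, OF wf_measure[of potential]]
      by (auto simp: in_measure)
  qed
  then show ?thesis by blast
qed

section \<open>From a winning strategy to a separating formula\<close>

text \<open>Duplicator's strongest reply: one copy for each element of the universe.\<close>

definition all_copies ::
  "nat \<Rightarrow> ('r, 'c, 'a) sapair set \<Rightarrow> ('r, 'c, 'a) sapair set"
where
  "all_copies i \<B> = {(B, \<beta>(i \<mapsto> b)) | B \<beta> b. (B, \<beta>) \<in> \<B> \<and> b \<in> univ B}"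

text \<open>Nonempty universes matter here, since a legal reply makes at least one copy of each
  pair.\<close>

lemma all_copies_in_replies:
  assumes "\<And>B \<beta>. (B, \<beta>) \<in> \<B> \<Longrightarrow> univ B \<noteq> {}"
  shows "all_copies i \<B> \<in> replies i \<B>"
  unfolding all_copies_def replies_def
  using assms by (intro CollectI exI[of _ "\<lambda>(B, \<beta>). univ B"]) auto

lemma domain_consistent_sym:
  "domain_consistent \<tau> V \<A> \<B> \<longleftrightarrow> domain_consistent \<tau> V \<B> \<A>"
  by (simp add: domain_consistent_def Un_commute)

lemma domain_consistent_pebble:
  assumes "domain_consistent \<tau> V \<A> \<B>" "valid_placement \<A> s"
  shows "domain_consistent \<tau> (insert i V) (place i s \<A>) (all_copies i \<B>)"
proof -
  have upd: "is_sapair \<tau> (A, \<alpha>(i \<mapsto> a)) \<and> dom (\<alpha>(i \<mapsto> a)) = insert i V"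
    if "(A, \<alpha>) \<in> \<A> \<union> \<B>" "a \<in> univ A" for A \<alpha> a
  proof -
    have "is_sapair \<tau> (A, \<alpha>)" "dom \<alpha> = V"
      using assms(1) that(1) unfolding domain_consistent_def by blast+
    with that(2) show ?thesis
      by (auto simp: is_sapair_def ran_def split: if_splits)
  qed
  show ?thesis
    unfolding domain_consistent_def
  proof clarify
    fix A \<alpha> assume "(A, \<alpha>) \<in> place i s \<A> \<union> all_copies i \<B>"
    then obtain \<alpha>' a where "(A, \<alpha>') \<in> \<A> \<union> \<B>" "a \<in> univ A" "\<alpha> = \<alpha>'(i \<mapsto> a)"
      using assms(2) unfolding place_def all_copies_def valid_placement_def by blast
    then show "is_sapair \<tau> (A, \<alpha>) \<and> dom \<alpha> = insert i V" using upd by blast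
  qed
qed

text \<open>Converse of \<open>separating_Ex\<close> against the strongest reply. The placement
  \<open>s\<close> supplies the witnesses on the left; on the right every element occurs in some
  copy, so refuting \<psi> on all copies excludes every witness.\<close>

lemma separating_ExI:
  assumes "separating (insert i V) (place i s \<A>) (all_copies i \<B>) \<psi>" "valid_placement \<A> s"
  shows "separating V \<A> \<B> (Ex i \<psi>)"
proof -
  have "s (A, \<alpha>) \<in> univ A \<and> sat A (\<alpha>(i \<mapsto> s (A, \<alpha>))) \<psi>" if "(A, \<alpha>) \<in> \<A>" for A \<alpha>
  proof -
    have "(A, \<alpha>(i \<mapsto> s (A, \<alpha>))) \<in> place i s \<A>"
      using that by (auto simp: place_def)
    then show ?thesis
      using assms that by (auto simp: separating_def valid_placement_def)
  qed
  moreover have "\<not> sat B (\<beta>(i \<mapsto> b)) \<psi>" if "(B, \<beta>) \<in> \<B>" "b \<in> univ B" for B \<beta> b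
  proof -
    have "(B, \<beta>(i \<mapsto> b)) \<in> all_copies i \<B>"
      using that by (auto simp: all_copies_def)
    then show ?thesis using assms(1) by (auto simp: separating_def)
  qed
  moreover have "Free \<psi> - {i} \<subseteq> V" using assms(1) by (auto simp: separating_def)
  ultimately show ?thesis by (auto simp: separating_def)
qed

lemma separating_AllI:
  assumes "separating (insert i V) (all_copies i \<A>) (place i s \<B>) \<psi>" "valid_placement \<B> s"
  shows "separating V \<A> \<B> (All i \<psi>)"
proof -
  have "separating V \<B> \<A> (Ex i (Neg \<psi>))"
    using assms by (intro separating_ExI) (auto simp: separating_swap)
  then show ?thesis by (auto simp: separating_def)
qed

text \<open>The tree \<open>t\<close> stands for Duplicator's answer, a real choice only in pebble
  moves, where all copies are made. Formulas for the children are joined by the connective belonging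
  to the move; for \<open>Close\<close>, which leaves no open child, the closing atom itself serves.
  Read contrapositively, a leaf without a formula passes this defect on to a child.\<close>

lemma formula_from_move:
  assumes f: "compositional_measure \<tau> k h f"
    and X: "consistent_node \<tau> X" and m: "legal \<tau> k h X m"
  shows "\<exists>t \<in> outcomes X m. (\<forall>Y \<in> set (open_nodes t). consistent_node \<tau> Y) \<and>
    ((\<forall>Y \<in> set (open_nodes t). node_formulas \<tau> k f Y \<noteq> {}) \<longrightarrow> node_formulas \<tau> k f X \<noteq> {})"
proof -
  obtain V \<A> \<B> r where X_eq: "X = (V, \<A>, \<B>, r)" by (cases X)
  have dc: "domain_consistent \<tau> V \<A> \<B>" using X by (simp add: X_eq consistent_node_def)
  then have univ: "univ A \<noteq> {}" if "(A, \<alpha>) \<in> \<A> \<union> \<B>" for A \<alpha>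
    using that unfolding domain_consistent_def is_sapair_def is_structure_def by blast
  have nonempty: "node_formulas \<tau> k f X \<noteq> {}"
    if "\<phi> \<in> FO \<tau> k" "f \<phi> = r" "separating V \<A> \<B> \<phi>" for \<phi>
    using that by (auto simp: X_eq node_formulas_def)
  note fs = measure_simps[OF f]
  show ?thesis
  proof (cases m)
    case (Pebble_Left i s g)
    have rep: "all_copies i \<B> \<in> replies i \<B>" using univ by (intro all_copies_in_replies) auto
    \<comment> \<open>Legality constrains the counter \<open>g\<close> on every possible reply, so
      in particular on this one.\<close>
    have s: "valid_placement \<A> s" and i: "i \<in> vars k" and g: "h_ex h (g (all_copies i \<B>)) = r"
      using m rep by (auto simp: X_eq Pebble_Left)
    let ?Y = "(insert i V, place i s \<A>, all_copies i \<B>, g (all_copies i \<B>))"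
    have "consistent_node \<tau> ?Y"
      using domain_consistent_pebble[OF dc s] by (simp add: consistent_node_def)
    moreover have "node_formulas \<tau> k f X \<noteq> {}" if Y: "node_formulas \<tau> k f ?Y \<noteq> {}"
    proof -
      obtain \<psi> where "\<psi> \<in> FO \<tau> k" "f \<psi> = g (all_copies i \<B>)"
        "separating (insert i V) (place i s \<A>) (all_copies i \<B>) \<psi>"
        using Y by (auto simp: node_formulas_def)
      then show ?thesis
        using i g s by (intro nonempty[of "Ex i \<psi>"] separating_ExI) (auto simp: fs(5))
    qed
    moreover have "Branch X [Open ?Y] \<in> outcomes X m"
      using rep by (auto simp: X_eq Pebble_Left)
    ultimately show ?thesis by (intro bexI[of _ "Branch X [Open ?Y]"]) auto
  next
    case (Pebble_Right i s g)
    have rep: "all_copies i \<A> \<in> replies i \<A>" using univ by (intro all_copies_in_replies) auto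
    have s: "valid_placement \<B> s" and i: "i \<in> vars k" and g: "h_all h (g (all_copies i \<A>)) = r"
      using m rep by (auto simp: X_eq Pebble_Right)
    let ?Y = "(insert i V, all_copies i \<A>, place i s \<B>, g (all_copies i \<A>))"
    have "consistent_node \<tau> ?Y"
      using domain_consistent_pebble[of \<tau> V \<B> \<A> s i] dc s
      by (simp add: consistent_node_def domain_consistent_sym)
    moreover have "node_formulas \<tau> k f X \<noteq> {}" if Y: "node_formulas \<tau> k f ?Y \<noteq> {}"
    proof -
      obtain \<psi> where "\<psi> \<in> FO \<tau> k" "f \<psi> = g (all_copies i \<A>)"
        "separating (insert i V) (all_copies i \<A>) (place i s \<B>) \<psi>"
        using Y by (auto simp: node_formulas_def)
      then show ?thesis
        using i g s by (intro nonempty[of "All i \<psi>"] separating_AllI) (auto simp: fs(6))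
    qed
    moreover have "Branch X [Open ?Y] \<in> outcomes X m"
      using rep by (auto simp: X_eq Pebble_Right)
    ultimately show ?thesis by (intro bexI[of _ "Branch X [Open ?Y]"]) auto
  next
    case (Split_Left \<A>1 \<A>2 r1 r2)
    then have A: "\<A> = \<A>1 \<union> \<A>2" and r: "h_or h r1 r2 = r" using m by (auto simp: X_eq)
    have "consistent_node \<tau> (V, \<A>1, \<B>, r1)" "consistent_node \<tau> (V, \<A>2, \<B>, r2)"
      using dc by (simp_all add: A consistent_node_def domain_consistent_def ball_Un)
    moreover have "node_formulas \<tau> k f X \<noteq> {}"
      if Y: "node_formulas \<tau> k f (V, \<A>1, \<B>, r1) \<noteq> {}" "node_formulas \<tau> k f (V, \<A>2, \<B>, r2) \<noteq> {}"
    proof -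
      obtain \<psi> \<gamma> where "\<psi> \<in> FO \<tau> k" "f \<psi> = r1" "separating V \<A>1 \<B> \<psi>"
        "\<gamma> \<in> FO \<tau> k" "f \<gamma> = r2" "separating V \<A>2 \<B> \<gamma>"
        using Y by (auto simp: node_formulas_def)
      then show ?thesis
        using r by (intro nonempty[of "Or \<psi> \<gamma>"]) (auto simp: fs(3) A separating_def)
    qed
    ultimately show ?thesis by (simp add: X_eq Split_Left)
  next
    case (Split_Right \<B>1 \<B>2 r1 r2)
    then have B: "\<B> = \<B>1 \<union> \<B>2" and r: "h_and h r1 r2 = r" using m by (auto simp: X_eq)
    have "consistent_node \<tau> (V, \<A>, \<B>1, r1)" "consistent_node \<tau> (V, \<A>, \<B>2, r2)"
      using dc by (simp_all add: B consistent_node_def domain_consistent_def ball_Un)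
    moreover have "node_formulas \<tau> k f X \<noteq> {}"
      if Y: "node_formulas \<tau> k f (V, \<A>, \<B>1, r1) \<noteq> {}" "node_formulas \<tau> k f (V, \<A>, \<B>2, r2) \<noteq> {}"
    proof -
      obtain \<psi> \<gamma> where "\<psi> \<in> FO \<tau> k" "f \<psi> = r1" "separating V \<A> \<B>1 \<psi>"
        "\<gamma> \<in> FO \<tau> k" "f \<gamma> = r2" "separating V \<A> \<B>2 \<gamma>"
        using Y by (auto simp: node_formulas_def)
      then show ?thesis
        using r by (intro nonempty[of "And \<psi> \<gamma>"]) (auto simp: fs(4) B separating_def)
    qed
    ultimately show ?thesis by (simp add: X_eq Split_Right)
  next
    case (Swap q)
    then have r: "h_neg h q = r" using m by (simp add: X_eq)
    have "consistent_node \<tau> (V, \<B>, \<A>, q)"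
      using dc by (simp add: consistent_node_def domain_consistent_sym)
    moreover have "node_formulas \<tau> k f X \<noteq> {}" if Y: "node_formulas \<tau> k f (V, \<B>, \<A>, q) \<noteq> {}"
    proof -
      obtain \<psi> where "\<psi> \<in> FO \<tau> k" "f \<psi> = q" "separating V \<B> \<A> \<psi>"
        using Y by (auto simp: node_formulas_def)
      then show ?thesis
        using r by (intro nonempty[of "Neg \<psi>"]) (auto simp: fs(2) separating_swap)
    qed
    ultimately show ?thesis by (simp add: X_eq Swap)
  next
    case Close
    then obtain P ts where "Atom P ts \<in> FO \<tau> k" "separating V \<A> \<B> (Atom P ts)" "h_atomic h P = r"
      using m by (auto simp: X_eq)
    then have "node_formulas \<tau> k f X \<noteq> {}" by (intro nonempty[of "Atom P ts"]) (auto simp: fs(1))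
    then show ?thesis by (simp add: X_eq Close)
  qed
qed

text \<open>Dependent choice: an invariant that forbids termination and that some reply preserves
  yields a play without end.\<close>

lemma infinite_play:
  assumes start: "I (Open X0)"
    and step: "\<And>H. partial_play X0 \<sigma> H \<Longrightarrow> I (last H) \<Longrightarrow>
      \<not> all_closed (last H) \<and> (\<exists>T \<in> next_trees (last H) (\<sigma> H). I T)"
  shows "\<exists>T. \<forall>n. partial_play X0 \<sigma> (map T [0..<Suc n])"
proof -
  define nxt where "nxt H = (SOME T. T \<in> next_trees (last H) (\<sigma> H) \<and> I T)" for H
  \<comment> \<open>Whole histories are built, not single trees, because the strategy may consult
    everything played so far.\<close>
  define Hs where "Hs = rec_nat [Open X0] (\<lambda>_ H. H @ [nxt H])"
  have Hs: "Hs 0 = [Open X0]" "\<And>n. Hs (Suc n) = Hs n @ [nxt (Hs n)]"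
    by (simp_all add: Hs_def)
  have play: "partial_play X0 \<sigma> (Hs n) \<and> I (last (Hs n))" for n
  proof (induction n)
    case 0
    then show ?case using start by (simp add: Hs partial_play.start)
  next
    case (Suc n)
    then have open_last: "\<not> all_closed (last (Hs n))"
      and ex: "\<exists>T. T \<in> next_trees (last (Hs n)) (\<sigma> (Hs n)) \<and> I T"
      using step by blast+
    have "nxt (Hs n) \<in> next_trees (last (Hs n)) (\<sigma> (Hs n)) \<and> I (nxt (Hs n))"
      unfolding nxt_def by (rule someI_ex[OF ex])
    with Suc open_last show ?case by (auto simp: Hs intro: partial_play.step)
  qed
  \<comment> \<open>Each history extends the previous one by a tree, so all are initial segments of
    the sequence of their last trees. History \<open>n\<close> holds \<open>n + 1\<close> trees,
    hence the bound \<open>Suc n\<close>.\<close>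
  have "Hs n = map (\<lambda>n. last (Hs n)) [0..<Suc n]" for n
    by (induction n) (simp_all add: Hs)
  with play show ?thesis by metis
qed

text \<open>If the root had no formula, Duplicator could always keep an open leaf without one, and
  the resulting infinite play would contradict winning.\<close>

lemma formula_from_winning_strategy:
  fixes X0 :: "('r, 'c, 'a) node"
  assumes f: "compositional_measure \<tau> k h f"
    and X0: "consistent_node \<tau> X0" and \<sigma>: "winning_strategy \<tau> k h X0 \<sigma>"
  shows "node_formulas \<tau> k f X0 \<noteq> {}"
proof
  assume bad: "node_formulas \<tau> k f X0 = {}"
  \<comment> \<open>The second conjunct supplies an open leaf, so the play is not over; consistency
    makes all copies a legal reply.\<close>
  define I where "I T \<longleftrightarrow> (\<forall>Y \<in> set (open_nodes T). consistent_node \<tau> Y) \<and>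
    (\<exists>Y \<in> set (open_nodes T). node_formulas \<tau> k f Y = {})"
    for T :: "('r, 'c, 'a) node gtree"
  have "\<exists>T. \<forall>n. partial_play X0 \<sigma> (map T [0..<Suc n])"
  proof (rule infinite_play)
    show "I (Open X0)" using bad X0 by (simp add: I_def)
    fix H assume H: "partial_play X0 \<sigma> H" "I (last H)"
    have open_last: "\<not> all_closed (last H)"
      using H(2) by (auto simp: I_def all_closed_iff_open_nodes)
    obtain p m where pm: "\<sigma> H = (p, m)" by force
    have "legal_at \<tau> k h (last H) (\<sigma> H)"
      using \<sigma> H(1) open_last by (auto simp: winning_strategy_def)
    then obtain X where X: "open_leaf p (last H) = Some X" "legal \<tau> k h X m"
      by (auto simp: legal_at_def pm)
    obtain ls rs where graft: "open_nodes (last H) = ls @ X # rs"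
      "\<And>s. open_nodes (graft p s (last H)) = ls @ open_nodes s @ rs"
      using open_nodes_graft[OF X(1)] by blast
    have "consistent_node \<tau> X" using H(2) by (auto simp: I_def graft)
    then obtain t where t: "t \<in> outcomes X m" "\<forall>Y \<in> set (open_nodes t). consistent_node \<tau> Y"
      "(\<forall>Y \<in> set (open_nodes t). node_formulas \<tau> k f Y \<noteq> {}) \<longrightarrow> node_formulas \<tau> k f X \<noteq> {}"
      using formula_from_move[OF f _ X(2)] by blast
    \<comment> \<open>A leaf without a formula either lies in \<open>ls\<close> or \<open>rs\<close>
      and survives, or is \<open>X\<close>, and then \<open>t\<close> contains another one.\<close>
    have "I (graft p t (last H))"
      using H(2) t(2,3) by (auto simp: I_def graft)
    moreover have "graft p t (last H) \<in> next_trees (last H) (\<sigma> H)"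
      using X(1) t(1) unfolding next_trees_def pm prod.case by blast
    ultimately show "\<not> all_closed (last H) \<and> (\<exists>T \<in> next_trees (last H) (\<sigma> H). I T)"
      using open_last by blast
  qed
  with \<sigma> show False unfolding winning_strategy_def by blast
qed

section \<open>The equivalence of strategies and separating formulas\<close>

theorem theorem6p8:
  fixes \<tau> :: "('r, 'c) vocabulary"
    and k r :: nat
    and h :: "'r measure_funs"
    and f :: "('r, 'c) fm \<Rightarrow> nat"
    and V :: "nat set"
    and \<A> \<B> :: "('r, 'c, 'a) sapair set"
  assumes "finite_vocabulary \<tau>"
    and "compositional_measure \<tau> k h f"
    and "domain_consistent \<tau> V \<A> \<B>"
    and "V \<subseteq> vars k"
  shows "spoiler_wins_SG \<tau> r k h V \<A> \<B> \<longleftrightarrow>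
    (\<exists>\<phi> \<in> FO \<tau> k. f \<phi> = r \<and> separating V \<A> \<B> \<phi>)"
proof -
  have "spoiler_wins_SG \<tau> r k h V \<A> \<B> \<longleftrightarrow> node_formulas \<tau> k f (V, \<A>, \<B>, r) \<noteq> {}"
  proof
    assume "spoiler_wins_SG \<tau> r k h V \<A> \<B>"
    then show "node_formulas \<tau> k f (V, \<A>, \<B>, r) \<noteq> {}"
      using formula_from_winning_strategy[OF assms(2)] assms(3)
      unfolding spoiler_wins_SG_def consistent_node_def by blast
  next
    assume "node_formulas \<tau> k f (V, \<A>, \<B>, r) \<noteq> {}"
    then show "spoiler_wins_SG \<tau> r k h V \<A> \<B>"
      unfolding spoiler_wins_SG_def by (rule winning_strategy_from_formula[OF assms(2)])
  qed
  then show ?thesis by (auto simp: node_formulas_def)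
qed

end
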